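(* Let $s \geq 1$ and $t \geq 2$ be integers and let $\beta_{s,t}$ be the type-$\beta$ comb with $s$ teeth of length $t$. Then the number of linear extensions of $\beta_{s,t}$ that avoid both patterns $213$ and $312$ equals $2^{s-1}$.
   Context: A linear extension of a finite poset $P$ on a set of integers is a listing $v=[v_1,\dots,v_n]$ of all elements of $P$, each exactly once, such that whenever $a \leq_P b$, $a$ appears before $b$. For $w \in S_3$, a sequence $v$ of distinct integers contains $w$ if there are indices $i<j<k$ with $(v_i,v_j,v_k)$ in the same relative order as $(w_1,w_2,w_3)$; otherwise $v$ avoids $w$. The type-$\beta$ comb $\beta_{s,t}$ is the poset on $\{1,\dots,st\}$ whose order is generated by the relations $ct+1 \leq (c+1)t+1$ for $0 \leq c \leq s-2$ (the spine) and $ct+j \leq ct+j+1$ for $0 \leq c \leq s-1$, $1 \leq j \leq t-1$ (the teeth $\{ct+1,\dots,ct+t\}$). *)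

theory Defs
  imports Main
begin

(* A poset is given by its carrier A and its full (reflexive) order relation r. Because r is
   reflexive on A, "appears before" is the weak comparison of positions. *)
definition linear_extensions :: "'a set \<Rightarrow> 'a rel \<Rightarrow> 'a list set" where
  "linear_extensions A r =
     {v. set v = A \<and> distinct v \<and>
         (\<forall>i < length v. \<forall>j < length v. (v ! i, v ! j) \<in> r \<longrightarrow> i \<le> j)}"

definition same_relative_order :: "'a::linorder list \<Rightarrow> 'b::linorder list \<Rightarrow> bool" where
  "same_relative_order u w \<longleftrightarrow>
     length u = length w \<and>
     (\<forall>a < length u. \<forall>b < length u. u ! a < u ! b \<longleftrightarrow> w ! a < w ! b)"

(* Patterns w are elements of S_3 in one-line notation, such as [2, 1, 3]. *)
definition contains_pattern3 :: "'a::linorder list \<Rightarrow> nat list \<Rightarrow> bool" where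
  "contains_pattern3 v w \<longleftrightarrow>
     (\<exists>i j k. i < j \<and> j < k \<and> k < length v \<and> same_relative_order [v ! i, v ! j, v ! k] w)"

definition avoids_pattern3 :: "'a::linorder list \<Rightarrow> nat list \<Rightarrow> bool" where
  "avoids_pattern3 v w \<longleftrightarrow> \<not> contains_pattern3 v w"

definition comb_carrier :: "nat \<Rightarrow> nat \<Rightarrow> nat set" where
  "comb_carrier s t = {1..s * t}"

definition comb_spine :: "nat \<Rightarrow> nat \<Rightarrow> nat rel" where
  "comb_spine s t = {(c * t + 1, (c + 1) * t + 1) | c. c + 2 \<le> s}"

definition comb_teeth :: "nat \<Rightarrow> nat \<Rightarrow> nat rel" where
  "comb_teeth s t = {(c * t + j, c * t + j + 1) | c j. c < s \<and> 1 \<le> j \<and> j + 1 \<le> t}"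

(* The reflexive transitive closure is reflexive on all of nat, hence the restriction. *)
definition comb_order :: "nat \<Rightarrow> nat \<Rightarrow> nat rel" where
  "comb_order s t = Restr ((comb_spine s t \<union> comb_teeth s t)\<^sup>*) (comb_carrier s t)"

lemma comb_generators_in_carrier:
  assumes "t \<ge> 1"
  shows "comb_spine s t \<union> comb_teeth s t \<subseteq> comb_carrier s t \<times> comb_carrier s t"
proof -
  have bound: "c * t + j \<le> s * t" if "c < s" "j \<le> t" for c j
  proof -
    have "c * t + j \<le> Suc c * t" using that by simp
    also have "\<dots> \<le> s * t" using that by (intro mult_le_mono1) simp
    finally show ?thesis .
  qed
  have "comb_spine s t \<subseteq> comb_carrier s t \<times> comb_carrier s t"
  proof
    fix p assume "p \<in> comb_spine s t"
    then obtain c where c: "p = (c * t + 1, (c + 1) * t + 1)" "c + 2 \<le> s"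
      unfolding comb_spine_def by auto
    show "p \<in> comb_carrier s t \<times> comb_carrier s t"
      using bound[of c 1] bound[of "c + 1" 1] c assms by (simp add: comb_carrier_def)
  qed
  moreover have "comb_teeth s t \<subseteq> comb_carrier s t \<times> comb_carrier s t"
  proof
    fix p assume "p \<in> comb_teeth s t"
    then obtain c j where c: "p = (c * t + j, c * t + j + 1)" "c < s" "1 \<le> j" "j + 1 \<le> t"
      unfolding comb_teeth_def by auto
    show "p \<in> comb_carrier s t \<times> comb_carrier s t"
      using bound[of c j] bound[of c "j + 1"] c by (simp add: comb_carrier_def)
  qed
  ultimately show ?thesis by simp
qed

lemma comb_closure_le:
  assumes "(a, b) \<in> (comb_spine s t \<union> comb_teeth s t)\<^sup>*"
  shows "a \<le> b"
  using assms by (induction rule: rtrancl_induct) (auto simp: comb_spine_def comb_teeth_def)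

lemma partial_order_on_comb_order:
  "partial_order_on (comb_carrier s t) (comb_order s t)"
proof -
  have "trans (comb_order s t)"
    unfolding comb_order_def by (auto intro!: transI)
  moreover have "antisym (comb_order s t)"
    unfolding comb_order_def by (auto intro!: antisymI dest!: comb_closure_le)
  ultimately show ?thesis
    by (auto simp: partial_order_on_def preorder_on_def refl_on_def comb_order_def)
qed

lemma finite_linear_extensions:
  assumes "finite A"
  shows "finite (linear_extensions A r)"
proof (rule finite_subset)
  show "linear_extensions A r \<subseteq> {v. set v \<subseteq> A \<and> length v = card A}"
    by (auto simp: linear_extensions_def distinct_card)
  show "finite {v. set v \<subseteq> A \<and> length v = card A}"
    by (rule finite_lists_length_eq[OF assms])
qed

end

(* A permutation avoids 213 and 312 exactly when it has no interior valley, i.e. when it increases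
   up to its maximum and decreases afterwards; it is then determined by the set R of entries after
   the maximum. In a naturally labelled poset such a word is a linear extension iff every element
   of R is maximal in the poset: whatever follows an element of R in the word is smaller than it.
   So the avoiding linear extensions correspond to the sets of maximal elements other than the
   largest label, and the maximal elements of the comb are the s multiples of t. *)
theory Submission
  imports Defs
begin

text \<open>Meant for \<open>m\<close> the maximum of \<open>A\<close> and \<open>R\<close> a subset
  of \<open>A - {m}\<close>: the set \<open>R\<close> then records exactly which entries follow the
  peak.\<close>

definition unimodal_word :: "'a::linorder set \<Rightarrow> 'a \<Rightarrow> 'a set \<Rightarrow> 'a list" where
  "unimodal_word A m R = sorted_list_of_set (A - R - {m}) @ m # rev (sorted_list_of_set R)"

definition maximal_elements :: "'a set \<Rightarrow> 'a rel \<Rightarrow> 'a set" where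
  "maximal_elements A r = {x \<in> A. \<forall>y. (x, y) \<in> r \<longrightarrow> y = x}"

text \<open>The bound is spelled with \<open>Suc\<close> to match what the simplifier makes of the
  length of a three-element list.\<close>

lemma less_3_cases: "(\<forall>a < Suc (Suc (Suc 0)). P a) \<longleftrightarrow> P 0 \<and> P 1 \<and> P 2"
  by (auto simp: less_Suc_eq numeral_2_eq_2)

lemma same_relative_order_3_iff:
  "same_relative_order [x, y, z] [2::nat, 1, 3] \<longleftrightarrow> y < x \<and> x < z"
  "same_relative_order [x, y, z] [3::nat, 1, 2] \<longleftrightarrow> y < z \<and> z < x"
  unfolding same_relative_order_def by (auto simp: less_3_cases)

text \<open>In both patterns the middle entry is the smallest. They differ only in which outer entry
  is larger, and distinctness rules out a tie.\<close>

lemma avoids_213_312_iff: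
  assumes "distinct v"
  shows "avoids_pattern3 v [2, 1, 3] \<and> avoids_pattern3 v [3, 1, 2] \<longleftrightarrow>
     (\<forall>i j k. i < j \<and> j < k \<and> k < length v \<longrightarrow> \<not> (v ! j < v ! i \<and> v ! j < v ! k))"
proof -
  have "v ! j < v ! i \<and> v ! j < v ! k \<longleftrightarrow>
      v ! j < v ! i \<and> v ! i < v ! k \<or> v ! j < v ! k \<and> v ! k < v ! i"
    if "i < j" "j < k" "k < length v" for i j k
  proof -
    have "v ! i \<noteq> v ! k" using assms that by (simp add: nth_eq_iff_index_eq)
    then show ?thesis by auto
  qed
  then show ?thesis
    unfolding avoids_pattern3_def contains_pattern3_def same_relative_order_3_iff by blast
qed

text \<open>The peak \<open>m\<close> acts as the missing third entry: a descent before it, followed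
  by \<open>m\<close>, would be a valley, and so would an ascent after it, preceded by
  \<open>m\<close>.\<close>

lemma sorted_peak_appendD:
  fixes m :: "'a::linorder"
  assumes "v = xs @ m # ys" "distinct v" "\<And>x. x \<in> set v \<Longrightarrow> x \<le> m"
    and valley: "\<And>i j k. i < j \<Longrightarrow> j < k \<Longrightarrow> k < length v \<Longrightarrow> \<not> (v ! j < v ! i \<and> v ! j < v ! k)"
  shows "sorted_wrt (<) xs" and "sorted_wrt (>) ys"
proof -
  show "sorted_wrt (<) xs"
    unfolding sorted_wrt_iff_nth_less
  proof (intro allI impI)
    fix i j assume ij: "i < j" "j < length xs"
    have "v ! j \<noteq> v ! i" using assms(1,2) ij by (simp add: nth_eq_iff_index_eq)
    moreover have "v ! j < v ! length xs"
      using assms(1-3) ij by (force simp: nth_append order.strict_iff_order)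
    ultimately show "xs ! i < xs ! j"
      using valley[of i j "length xs"] assms(1) ij by (auto simp: nth_append)
  qed
  show "sorted_wrt (>) ys"
    unfolding sorted_wrt_iff_nth_less
  proof (intro allI impI)
    fix i j assume ij: "i < j" "j < length ys"
    let ?i = "Suc (length xs + i)" and ?j = "Suc (length xs + j)"
    have nth: "v ! ?i = ys ! i" "v ! ?j = ys ! j" "v ! length xs = m"
      using assms(1) by (simp_all add: nth_append)
    have "ys ! i \<noteq> ys ! j" using assms(1,2) ij by (simp add: nth_eq_iff_index_eq)
    moreover have "ys ! i < m"
      using assms(1-3) ij by (force simp: order.strict_iff_order)
    ultimately show "ys ! i > ys ! j"
      using valley[of "length xs" ?i ?j] assms(1) ij nth by auto
  qed
qed

context
  fixes A R :: "'a::linorder set" and m :: 'a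
  assumes fin: "finite A" and R: "R \<subseteq> A - {m}" and m: "m \<in> A" "\<And>x. x \<in> A \<Longrightarrow> x \<le> m"
begin

lemma finite_right: "finite R"
  using fin R finite_subset by blast

lemma set_unimodal_word: "set (unimodal_word A m R) = A"
  using fin finite_right R m by (auto simp: unimodal_word_def)

lemma distinct_unimodal_word: "distinct (unimodal_word A m R)"
  using fin finite_right R m by (auto simp: unimodal_word_def)

text \<open>Position \<open>j\<close> lies either in the increasing part, peak included, where all
  earlier entries are smaller, or in the decreasing part, where all later entries are
  smaller.\<close>

lemma unimodal_word_cases:
  assumes "i < j" "j < length (unimodal_word A m R)"
  obtains (left) "unimodal_word A m R ! i < unimodal_word A m R ! j" "unimodal_word A m R ! j \<notin> R"
  | (right) "unimodal_word A m R ! j \<in> R"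
      "\<And>k. j < k \<Longrightarrow> k < length (unimodal_word A m R) \<Longrightarrow>
         unimodal_word A m R ! k < unimodal_word A m R ! j"
proof -
  \<comment> \<open>The peak joins the increasing half, which stays increasing because
    \<open>m\<close> is the maximum; its set becomes \<open>A - R\<close>.\<close>
  define xs where "xs = sorted_list_of_set (A - R - {m}) @ [m]"
  define ys where "ys = rev (sorted_list_of_set R)"
  have w: "unimodal_word A m R = xs @ ys"
    by (simp add: xs_def ys_def unimodal_word_def)
  have xs: "sorted_wrt (<) xs" "set xs = A - R"
    using fin m R by (auto simp: xs_def sorted_wrt_append less_le)
  have ys: "sorted_wrt (>) ys" "set ys = R"
    using finite_right by (auto simp: ys_def sorted_wrt_rev)
  show thesis
  proof (cases "j < length xs")
    case True
    then show ?thesis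
      using xs assms by (intro left) (auto simp: w nth_append sorted_wrt_iff_nth_less dest: nth_mem)
  next
    case False
    then show ?thesis
      using ys assms
      by (intro right) (auto simp: w nth_append sorted_wrt_iff_nth_less)
  qed
qed

end

lemma inj_on_unimodal_word:
  assumes "finite A"
  shows "inj_on (unimodal_word A m) (Pow (A - {m}))"
proof (rule inj_onI)
  fix R S assume RS: "R \<in> Pow (A - {m})" "S \<in> Pow (A - {m})"
    and eq: "unimodal_word A m R = unimodal_word A m S"
  have fin: "finite R" "finite S" using RS assms by (auto intro: finite_subset)
  \<comment> \<open>As \<open>m\<close> lies in neither half, its single occurrence fixes the split,
    so equal words have equal right halves.\<close>
  have "m \<notin> set (sorted_list_of_set (A - R - {m}))" "m \<notin> set (rev (sorted_list_of_set R))"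
    using RS fin assms by auto
  from append_Cons_eq_iff[OF this] eq
  have "rev (sorted_list_of_set R) = rev (sorted_list_of_set S)"
    by (simp add: unimodal_word_def)
  then show "R = S" using fin sorted_list_of_set_inject by auto
qed

theorem card_avoiding_linear_extensions:
  fixes A :: "'a::linorder set"
  assumes "finite A" "A \<noteq> {}" and rA: "r \<subseteq> A \<times> A"
    and natural: "\<And>a b. (a, b) \<in> r \<Longrightarrow> a \<le> b"
  shows "card {v \<in> linear_extensions A r.
           avoids_pattern3 v [2, 1, 3] \<and> avoids_pattern3 v [3, 1, 2]}
         = 2 ^ (card (maximal_elements A r) - 1)"
proof -
  define m where "m = Max A"
  define M where "M = maximal_elements A r - {m}"
  let ?X = "{v \<in> linear_extensions A r.
              avoids_pattern3 v [2, 1, 3] \<and> avoids_pattern3 v [3, 1, 2]}"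
  have m: "m \<in> A" "\<And>x. x \<in> A \<Longrightarrow> x \<le> m" using assms(1,2) by (auto simp: m_def)
  have MA: "M \<subseteq> A - {m}" by (auto simp: M_def maximal_elements_def)
  have "unimodal_word A m ` Pow M = ?X"
  proof (intro equalityI subsetI)
    fix v assume "v \<in> unimodal_word A m ` Pow M"
    then obtain R where RM: "R \<subseteq> M" and v: "v = unimodal_word A m R" by auto
    have R: "R \<subseteq> A - {m}" using RM MA by auto
    note W = assms(1) R m
    have set: "set v = A" and dist: "distinct v"
      using set_unimodal_word[OF W] distinct_unimodal_word[OF W] v by auto
    have ext: "i \<le> j" if ij: "i < length v" "j < length v" "(v ! i, v ! j) \<in> r" for i j
    proof (rule ccontr)
      assume "\<not> i \<le> j"
      then have "j < i" by simp
      then have "v ! j \<noteq> v ! i" using dist ij by (simp add: nth_eq_iff_index_eq)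
      \<comment> \<open>For an inverted pair the later entry \<open>v ! i\<close> is not maximal,
        hence not in \<open>R\<close>, and by \<open>natural\<close> it is at most
        \<open>v ! j\<close>. This contradicts both cases for the positions
        \<open>j < i\<close>.\<close>
      then have "v ! i \<notin> R" "\<not> v ! j < v ! i"
        using RM ij natural by (auto simp: M_def maximal_elements_def dest: leD)
      then show False
        using unimodal_word_cases[OF W \<open>j < i\<close>] ij(1) v by metis
    qed
    \<comment> \<open>If \<open>j\<close> is at or before the peak, entry \<open>i\<close> is
      smaller than entry \<open>j\<close>; if after it, entry \<open>k\<close> is.\<close>
    have "\<not> (v ! j < v ! i \<and> v ! j < v ! k)"
      if "i < j" "j < k" "k < length v" for i j k
      using unimodal_word_cases[OF W \<open>i < j\<close>] that v by (metis less_trans less_asym)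
    then have "avoids_pattern3 v [2, 1, 3] \<and> avoids_pattern3 v [3, 1, 2]"
      using avoids_213_312_iff[OF dist] by blast
    then show "v \<in> ?X"
      using set dist ext by (simp add: linear_extensions_def)
  next
    fix v assume vX: "v \<in> ?X"
    then have "v \<in> linear_extensions A r" by blast
    then have set: "set v = A" and dist: "distinct v"
      and ext: "\<And>i j. i < length v \<Longrightarrow> j < length v \<Longrightarrow> (v ! i, v ! j) \<in> r \<Longrightarrow> i \<le> j"
      by (auto simp: linear_extensions_def)
    have valley: "\<And>i j k. i < j \<Longrightarrow> j < k \<Longrightarrow> k < length v \<Longrightarrow> \<not> (v ! j < v ! i \<and> v ! j < v ! k)"
      using vX avoids_213_312_iff[OF dist] by blast
    obtain xs ys where v: "v = xs @ m # ys"
      using m(1) set by (metis split_list)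
    have sorted: "sorted_wrt (<) xs" "sorted_wrt (>) ys"
      using sorted_peak_appendD[OF v dist _ valley] set m(2) by auto
    have "set xs = A - set ys - {m}" using set dist v by auto
    with sorted have "xs = sorted_list_of_set (A - set ys - {m})"
      by (metis sorted_list_of_set.idem_if_sorted_distinct strict_sorted_iff)
    moreover have "rev ys = sorted_list_of_set (set ys)"
      using sorted(2)
      by (metis set_rev sorted_list_of_set.idem_if_sorted_distinct sorted_wrt_rev
          rev_rev_ident strict_sorted_iff)
    ultimately have "v = unimodal_word A m (set ys)"
      by (metis rev_rev_ident unimodal_word_def v)
    \<comment> \<open>Anything strictly above \<open>y\<close> in \<open>r\<close> has a larger
      label and occurs later in \<open>v\<close>. Since \<open>ys\<close> is decreasing, no such
      element exists.\<close>
    moreover have "set ys \<subseteq> M"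
    proof
      fix y assume y: "y \<in> set ys"
      then obtain i where i: "i < length ys" "y = ys ! i" by (metis in_set_conv_nth)
      \<comment> \<open>The offset skips \<open>xs\<close> and the peak.\<close>
      let ?i = "Suc (length xs + i)"
      have vi: "v ! ?i = y" "?i < length v" using v i by (simp_all add: nth_append)
      have "z = y" if yz: "(y, z) \<in> r" for z
      proof (rule ccontr)
        assume "z \<noteq> y"
        then have "y < z" using natural[OF yz] by simp
        obtain j where j: "j < length v" "z = v ! j"
          using yz rA set by (metis in_set_conv_nth mem_Sigma_iff subsetD)
        have "?i \<le> j" using ext[of ?i j] vi j yz by simp
        with \<open>z \<noteq> y\<close> vi j have "?i < j" by (metis le_neq_implies_less)
        define d where "d = j - Suc (length xs)"
        have d: "j = Suc (length xs + d)" "i < d" using \<open>?i < j\<close> by (auto simp: d_def)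
        have "z = ys ! d" "d < length ys" using d(1) j v by (simp_all add: nth_append)
        then have "z < y" using sorted(2) d i by (simp add: sorted_wrt_iff_nth_less)
        with \<open>y < z\<close> show False by simp
      qed
      moreover have "y \<in> A" "y \<noteq> m" using y set dist v by auto
      ultimately show "y \<in> M" by (auto simp: M_def maximal_elements_def)
    qed
    ultimately show "v \<in> unimodal_word A m ` Pow M" by blast
  qed
  moreover have "inj_on (unimodal_word A m) (Pow M)"
    using inj_on_unimodal_word[OF assms(1)] MA by (blast intro: inj_on_subset)
  moreover have "finite M" using assms(1) MA by (blast intro: finite_subset)
  ultimately have "card ?X = 2 ^ card M"
    by (metis card_image card_Pow)
  \<comment> \<open>No label exceeds \<open>m\<close>, so \<open>natural\<close> makes it maximal.
    As the peak it is never a free choice, whence the \<open>- 1\<close> in the exponent.\<close>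
  moreover have "m \<in> maximal_elements A r"
    using m natural rA by (fastforce simp: maximal_elements_def)
  ultimately show ?thesis by (simp add: M_def)
qed

text \<open>Every generator starts at some \<open>c * t + j\<close> with
  \<open>1 \<le> j < t\<close>; for the spine \<open>j = 1\<close>, which is below \<open>t\<close>
  because \<open>t \<ge> 2\<close>. So no generator leaves a multiple of \<open>t\<close>.\<close>

lemma comb_order_from_multiple:
  assumes "t \<ge> 2" "t dvd x" "(x, y) \<in> comb_order s t"
  shows "y = x"
proof -
  have "\<not> t dvd c * t + j" if "1 \<le> j" "j < t" for c j
    using that by (auto simp: dvd_add_right_iff dest: nat_dvd_not_less)
  with assms(1,2) have "(x, z) \<notin> comb_spine s t \<union> comb_teeth s t" for z
    by (auto simp: comb_spine_def comb_teeth_def Suc_le_eq simp del: One_nat_def)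
  moreover have "(x, y) \<in> (comb_spine s t \<union> comb_teeth s t)\<^sup>*"
    using assms(3) by (simp add: comb_order_def)
  ultimately show ?thesis by (auto elim: converse_rtranclE)
qed

text \<open>A non-multiple of \<open>t\<close> is not the end of its tooth: quotient and remainder
  by \<open>t\<close> give the tooth index and the place in it.\<close>

lemma comb_order_Suc:
  assumes "x \<in> comb_carrier s t" "\<not> t dvd x"
  shows "(x, Suc x) \<in> comb_order s t"
proof -
  have x: "1 \<le> x" "x \<le> s * t" using assms(1) by (auto simp: comb_carrier_def)
  \<comment> \<open>The last label \<open>s * t\<close> is itself a multiple of \<open>t\<close>;
    excluding it makes the tooth index less than \<open>s\<close>.\<close>
  then have "x \<noteq> s * t" "t > 0" using assms(2) by (auto intro: Nat.gr0I)
  with x have "x < s * t" by simp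
  then have "x div t < s" by (simp add: less_mult_imp_div_less)
  moreover have "1 \<le> x mod t" using assms(2) by (simp add: dvd_eq_mod_eq_0 Suc_le_eq)
  moreover have "x mod t + 1 \<le> t" using mod_less_divisor[OF \<open>t > 0\<close>, of x] by simp
  moreover have "x = x div t * t + x mod t" by simp
  ultimately have "(x, Suc x) \<in> comb_teeth s t"
    unfolding comb_teeth_def
    by (intro CollectI exI[of _ "x div t"] exI[of _ "x mod t"]) simp
  then show ?thesis
    using x \<open>x < s * t\<close> by (auto simp: comb_order_def comb_carrier_def)
qed

text \<open>Non-multiples of \<open>t\<close> lie below their successors, and multiples have nothing
  above them. The image form reduces the count to injectivity of multiplication by
  \<open>t\<close>.\<close>

lemma maximal_elements_comb:
  assumes "t \<ge> 2"
  shows "maximal_elements (comb_carrier s t) (comb_order s t) = (\<lambda>c. c * t) ` {1..s}"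
proof -
  have "(\<forall>y. (x, y) \<in> comb_order s t \<longrightarrow> y = x) \<longleftrightarrow> t dvd x"
    if "x \<in> comb_carrier s t" for x
    using comb_order_from_multiple[OF assms] comb_order_Suc[OF that] by (metis n_not_Suc_n)
  then have "maximal_elements (comb_carrier s t) (comb_order s t) = {x \<in> comb_carrier s t. t dvd x}"
    by (auto simp: maximal_elements_def)
  also have "\<dots> = (\<lambda>c. c * t) ` {1..s}"
  proof (intro equalityI subsetI)
    fix x assume "x \<in> {x \<in> comb_carrier s t. t dvd x}"
    then obtain c where "x = c * t" "1 \<le> c * t" "c * t \<le> s * t"
      by (auto simp: comb_carrier_def mult.commute elim!: dvdE)
    moreover from this have "1 \<le> c" "c \<le> s" using assms by (auto intro: Suc_leI Nat.gr0I)
    ultimately show "x \<in> (\<lambda>c. c * t) ` {1..s}" by auto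
  next
    fix x assume "x \<in> (\<lambda>c. c * t) ` {1..s}"
    then show "x \<in> {x \<in> comb_carrier s t. t dvd x}"
      using assms by (auto simp: comb_carrier_def Suc_le_eq)
  qed
  finally show ?thesis .
qed

theorem theorem18:
  fixes s t :: nat
  assumes "s \<ge> 1" and "t \<ge> 2"
  shows "card {v \<in> linear_extensions (comb_carrier s t) (comb_order s t).
                 avoids_pattern3 v [2, 1, 3] \<and> avoids_pattern3 v [3, 1, 2]} = 2 ^ (s - 1)"
proof -
  have "inj_on (\<lambda>c. c * t) {1..s}" using assms by (auto intro: inj_onI)
  then have "card (maximal_elements (comb_carrier s t) (comb_order s t)) = s"
    using maximal_elements_comb[OF assms(2)] by (simp add: card_image)
  moreover have "finite (comb_carrier s t)" "comb_carrier s t \<noteq> {}"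
    using assms by (auto simp: comb_carrier_def)
  moreover have "comb_order s t \<subseteq> comb_carrier s t \<times> comb_carrier s t"
    by (auto simp: comb_order_def)
  moreover have "a \<le> b" if "(a, b) \<in> comb_order s t" for a b
    using that comb_closure_le by (auto simp: comb_order_def)
  ultimately show ?thesis
    using card_avoiding_linear_extensions[of "comb_carrier s t" "comb_order s t"] by simp
qed

end
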